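(* Let $\omega\in\mathbb R$ with $|\omega|<\tfrac12$, and let $$\phi(t)=\sum_i A_i\,e^{\lambda_i t-c_i e^{2t}},\qquad t\ge 0,$$ be a finite sum with real $A_i,\lambda_i$ and $c_i>0$. Let $K_\phi$ be the same-sign Weyl kernel of $\phi$, i.e. for $x,y\ge 0$ $$K_\phi(x,y)=\frac12\int_{(x+y)/2}^{\infty} v\cosh(2\omega v)\,\phi\!\left(v+\frac{x-y}{2}\right)\phi\!\left(v-\frac{x-y}{2}\right)dv .$$ Then for all $x,y\ge0$, $$K_\phi(x,y)=\frac1{16}\sum_{\varepsilon=\pm1}\sum_{i,j}A_iA_j\,e^{(\lambda_i+\varepsilon\omega)x}e^{(\lambda_j+\varepsilon\omega)y}\Bigl[I_{\log}(\alpha_{ij},p_{ij})+(x+y)\,I_0(\alpha_{ij},p_{ij})\Bigr],$$ where $$\alpha_{ij}=c_ie^{2x}+c_je^{2y},\qquad p_{ij}=\frac{\lambda_i+\lambda_j+2\varepsilon\omega}{2},$$ $$I_0(\alpha,p)=\int_1^\infty q^{p-1}e^{-\alpha q}\,dq=\alpha^{-p}\Gamma(p,\alpha),\qquad I_{\log}(\alpha,p)=\partial_pI_0(\alpha,p)=\int_1^\infty \log(q)\,q^{p-1}e^{-\alpha q}\,dq .$$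
   Context: $\Gamma(p,\alpha)=\int_\alpha^\infty y^{p-1}e^{-y}\,dy$ is the upper incomplete gamma function ($\alpha>0$, $p\in\mathbb R$). The kernel $K_\phi$ is the restriction to $x,y\ge 0$ of the Weyl kernel $K_\omega(a,b)=\frac12\int_{|(a+b)/2|}^{\infty}v\cosh(2\omega v)\,\phi(v+\frac{a-b}{2})\,\phi(v-\frac{a-b}{2})\,dv$, with the finite core $\phi$ in place of the Riemann kernel. The quantity $p_{ij}$ depends on $\varepsilon$. *)

theory Defs
  imports "HOL-Analysis.Analysis"
begin

definition weyl_integrand :: "(real \<Rightarrow> real) \<Rightarrow> real \<Rightarrow> real \<Rightarrow> real \<Rightarrow> real \<Rightarrow> real" where
  "weyl_integrand \<phi> \<omega> a b v =
     v * cosh (2 * \<omega> * v) * \<phi> (v + (a - b) / 2) * \<phi> (v - (a - b) / 2)"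

definition weyl_kernel :: "(real \<Rightarrow> real) \<Rightarrow> real \<Rightarrow> real \<Rightarrow> real \<Rightarrow> real" where
  "weyl_kernel \<phi> \<omega> a b =
     1 / 2 * (LBINT v:{\<bar>(a + b) / 2\<bar>..}. weyl_integrand \<phi> \<omega> a b v)"

(* Meant for x, y >= 0 only; there it is the restriction of weyl_kernel, and phi is evaluated
   only at arguments >= min x y >= 0. *)
definition same_sign_weyl_kernel :: "(real \<Rightarrow> real) \<Rightarrow> real \<Rightarrow> real \<Rightarrow> real \<Rightarrow> real" where
  "same_sign_weyl_kernel \<phi> \<omega> x y =
     1 / 2 * (LBINT v:{(x + y) / 2..}. weyl_integrand \<phi> \<omega> x y v)"

lemma same_sign_weyl_kernel_eq_weyl_kernel:
  assumes "x \<ge> 0" "y \<ge> 0"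
  shows "same_sign_weyl_kernel \<phi> \<omega> x y = weyl_kernel \<phi> \<omega> x y"
  using assms by (simp add: same_sign_weyl_kernel_def weyl_kernel_def)

definition upper_Gamma :: "real \<Rightarrow> real \<Rightarrow> real" where
  "upper_Gamma p \<alpha> = (LBINT y:{\<alpha>..}. y powr (p - 1) * exp (- y))"

definition I0 :: "real \<Rightarrow> real \<Rightarrow> real" where
  "I0 \<alpha> p = (LBINT q:{1..}. q powr (p - 1) * exp (- \<alpha> * q))"

definition Ilog :: "real \<Rightarrow> real \<Rightarrow> real" where
  "Ilog \<alpha> p = (LBINT q:{1..}. ln q * q powr (p - 1) * exp (- \<alpha> * q))"

end

theory Submission
  imports Defs
begin

text \<open>
  Put \<open>v = s + (x + y) / 2\<close> and \<open>q = exp (2 * s)\<close>. The arguments of the two cores become \<open>s + x\<close> and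
  \<open>s + y\<close>, so a product of two terms of \<open>\<phi>\<close> turns into a power of \<open>q\<close> times \<open>exp (- \<alpha> * q)\<close>. The factor
  \<open>v = (ln q + x + y) / 2\<close> separates the two incomplete gamma integrals, and the exponents of
  \<open>cosh (2 * \<omega> * v)\<close> shift \<open>p\<close> by \<open>\<epsilon> * \<omega>\<close>.
\<close>

section \<open>Change of variables for set integrals over \<open>lborel\<close>\<close>

lemma set_integral_substitution_lborel:
  fixes f g g' :: "real \<Rightarrow> real"
  assumes S: "S \<in> sets borel" and gS: "g ` S \<in> sets borel"
    and der: "\<And>x. x \<in> S \<Longrightarrow> (g has_field_derivative g' x) (at x within S)"
    and inj: "inj_on g S"
    and [measurable]: "f \<in> borel_measurable borel" "g \<in> borel_measurable borel"
      "g' \<in> borel_measurable borel"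
    and f: "set_integrable lborel (g ` S) f"
  shows "set_integrable lborel S (\<lambda>x. \<bar>g' x\<bar> * f (g x))"
    and "(LBINT x:S. \<bar>g' x\<bar> * f (g x)) = (LBINT y:g ` S. f y)"
proof -
  have S': "S \<in> sets lebesgue"
    using S by auto
  have meas: "(\<lambda>x. indicator T x *\<^sub>R h x) \<in> borel_measurable lborel"
    if "T \<in> sets borel" "h \<in> borel_measurable borel" for T and h :: "real \<Rightarrow> real"
    using that by measurable
  \<comment> \<open>\<open>lebesgue\<close> is the completion of \<open>lborel\<close>, so for Borel
    integrands on Borel sets both notions of integrability agree. This carries the change of
    variables for absolute integrals over to \<open>lborel\<close>.\<close>
  have int_iff: "h absolutely_integrable_on T \<longleftrightarrow> set_integrable lborel T h"
    if "T \<in> sets borel" "h \<in> borel_measurable borel" for T and h :: "real \<Rightarrow> real"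
    unfolding set_integrable_def using meas[OF that] by (rule integrable_completion)
  have fm: "(\<lambda>x. \<bar>g' x\<bar> * f (g x)) \<in> borel_measurable borel"
    by measurable
  \<comment> \<open>The change of variables is an equivalence between pairs (integrability, value of
    the integral). Choosing the integral itself as the value makes the second component
    trivial.\<close>
  have "f absolutely_integrable_on g ` S \<and> integral (g ` S) f = integral (g ` S) f"
    using f gS by (simp add: int_iff)
  then have *: "(\<lambda>x. \<bar>g' x\<bar> * f (g x)) absolutely_integrable_on S \<and>
      integral S (\<lambda>x. \<bar>g' x\<bar> * f (g x)) = integral (g ` S) f"
    using has_absolute_integral_change_of_variables_1'[OF S' der inj] by blast
  then show **: "set_integrable lborel S (\<lambda>x. \<bar>g' x\<bar> * f (g x))"
    using int_iff[OF S fm] by simp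
  show "(LBINT x:S. \<bar>g' x\<bar> * f (g x)) = (LBINT y:g ` S. f y)"
    using * set_borel_integral_eq_integral(2)[OF **] set_borel_integral_eq_integral(2)[OF f]
    by simp
qed

section \<open>Integrability of the incomplete gamma integrands\<close>

lemma powr_le_exp_linear:
  fixes s b :: real
  assumes "b > 0"
  obtains C where "\<And>q. q \<ge> 1 \<Longrightarrow> q powr s \<le> exp (b * q + C)"
proof -
  \<comment> \<open>\<open>t\<close> is a positive exponent dominating \<open>s\<close>. Multiplying
    the bound \<open>ln (q / k) \<le> q / k\<close> by \<open>t\<close> gives slope
    \<open>t / k\<close>, and \<open>k\<close> is chosen to make this \<open>b\<close>.\<close>
  define t k where "t = max s 1" and "k = t / b"
  have pos: "t > 0" "k > 0"
    using assms by (auto simp: t_def k_def)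
  have "q powr s \<le> exp (b * q + t * ln k)" if q: "q \<ge> 1" for q
  proof -
    have "ln (q / k) \<le> q / k"
      using ln_le_minus_one[of "q / k"] q pos by auto
    then have "ln q \<le> q / k + ln k"
      using q pos by (simp add: ln_div)
    then have "t * ln q \<le> t * (q / k + ln k)"
      using pos by (intro mult_left_mono) auto
    also have "\<dots> = b * q + t * ln k"
      using pos assms by (simp add: k_def field_simps)
    finally have "t * ln q \<le> b * q + t * ln k" .
    moreover have "s * ln q \<le> t * ln q"
      using q by (intro mult_right_mono) (auto simp: t_def)
    ultimately show ?thesis
      using q by (simp add: powr_def)
  qed
  then show thesis
    by (rule that)
qed

text \<open>Half of the exponential decay absorbs the power of \<open>q\<close>; the other half is
  the integrable majorant.\<close>

lemma set_integrable_powr_exp: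
  fixes \<alpha> s :: real
  assumes "\<alpha> > 0"
  shows "set_integrable lborel {1..} (\<lambda>q. q powr s * exp (- \<alpha> * q))"
proof -
  obtain C where C: "\<And>q. q \<ge> 1 \<Longrightarrow> q powr s \<le> exp (\<alpha> / 2 * q + C)"
    using powr_le_exp_linear[of "\<alpha> / 2" s] assms by auto
  have "(\<lambda>q. exp (- (\<alpha> / 2) * q)) absolutely_integrable_on {1..}"
    using assms by (intro nonnegative_absolutely_integrable_1 integrable_on_exp_minus_to_infinity) auto
  then have "set_integrable lborel {1..} (\<lambda>q. exp (- (\<alpha> / 2) * q))"
    unfolding set_integrable_def by (subst (asm) integrable_completion) simp_all
  then have "set_integrable lborel {1..} (\<lambda>q. exp C * exp (- (\<alpha> / 2) * q))"
    by simp
  then show ?thesis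
  proof (rule set_integrable_bound)
    show "set_borel_measurable lborel {1..} (\<lambda>q. q powr s * exp (- \<alpha> * q))"
      unfolding set_borel_measurable_def by measurable
    have "q powr s * exp (- \<alpha> * q) \<le> exp C * exp (- (\<alpha> / 2) * q)" if "q \<ge> 1" for q
    proof -
      have "q powr s * exp (- \<alpha> * q) \<le> exp (\<alpha> / 2 * q + C) * exp (- \<alpha> * q)"
        using C[OF that] by (intro mult_right_mono) auto
      also have "\<dots> = exp C * exp (- (\<alpha> / 2) * q)"
        by (simp flip: exp_add)
      finally show ?thesis .
    qed
    then show "AE q in lborel. q \<in> {1..} \<longrightarrow>
        norm (q powr s * exp (- \<alpha> * q)) \<le> norm (exp C * exp (- (\<alpha> / 2) * q))"
      by (auto simp: abs_mult)
  qed
qed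

text \<open>On \<open>{1..}\<close> the logarithm costs at most one more power of
  \<open>q\<close>.\<close>

lemma set_integrable_ln_powr_exp:
  fixes \<alpha> s :: real
  assumes "\<alpha> > 0"
  shows "set_integrable lborel {1..} (\<lambda>q. ln q * q powr s * exp (- \<alpha> * q))"
proof (rule set_integrable_bound[OF set_integrable_powr_exp[OF assms, of "s + 1"]])
  show "set_borel_measurable lborel {1..} (\<lambda>q. ln q * q powr s * exp (- \<alpha> * q))"
    unfolding set_borel_measurable_def by measurable
  have "ln q * q powr s \<le> q powr (s + 1)" if "q \<ge> 1" for q :: real
    using ln_le_minus_one[of q] that
    by (simp add: powr_add mult.commute[of "ln q"] mult_left_mono)
  then show "AE q in lborel. q \<in> {1..} \<longrightarrow> norm (ln q * q powr s * exp (- \<alpha> * q)) \<le>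
      norm (q powr (s + 1) * exp (- \<alpha> * q))"
    by (auto simp: abs_mult)
qed

text \<open>Both claims come from the scaling \<open>q = y / \<alpha>\<close>, which maps
  \<open>{\<alpha>..}\<close> onto \<open>{1..}\<close>. The Jacobian \<open>1 / \<alpha>\<close>
  and the power \<open>p - 1\<close> together produce \<open>\<alpha> powr (- p)\<close>.\<close>

lemma
  fixes \<alpha> p :: real
  assumes "\<alpha> > 0"
  shows set_integrable_upper_Gamma:
      "set_integrable lborel {\<alpha>..} (\<lambda>y. y powr (p - 1) * exp (- y))"
    and I0_eq_upper_Gamma: "I0 \<alpha> p = \<alpha> powr (- p) * upper_Gamma p \<alpha>"
proof -
  let ?f = "\<lambda>q. q powr (p - 1) * exp (- \<alpha> * q)"
  let ?h = "\<lambda>y. \<bar>1 / \<alpha>\<bar> * ?f (y / \<alpha>)"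
  have im: "(\<lambda>y. y / \<alpha>) ` {\<alpha>..} = {1..}"
  proof (intro equalityI subsetI)
    fix q :: real assume "q \<in> {1..}"
    then show "q \<in> (\<lambda>y. y / \<alpha>) ` {\<alpha>..}"
      using assms by (intro image_eqI[of _ _ "\<alpha> * q"]) auto
  qed (use assms in auto)
  have f: "set_integrable lborel ((\<lambda>y. y / \<alpha>) ` {\<alpha>..}) ?f"
    unfolding im by (rule set_integrable_powr_exp[OF assms])
  have der: "((\<lambda>y. y / \<alpha>) has_field_derivative 1 / \<alpha>) (at y within {\<alpha>..})" for y
    using assms by (auto intro!: derivative_eq_intros)
  have inj: "inj_on (\<lambda>y. y / \<alpha>) {\<alpha>..}"
    using assms by (auto simp: inj_on_def)
  have h: "?h y = \<alpha> powr (- p) * (y powr (p - 1) * exp (- y))" if "y \<in> {\<alpha>..}" for y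
    using assms that by (simp add: powr_divide powr_diff powr_minus field_simps)
  note subst = set_integral_substitution_lborel[OF _ _ der inj _ _ _ f]
  have "set_integrable lborel {\<alpha>..} ?h"
    by (rule subst(1)) (auto simp: im)
  then have "set_integrable lborel {\<alpha>..} (\<lambda>y. \<alpha> powr (- p) * (y powr (p - 1) * exp (- y)))"
    by (rule set_integrable_cong[OF refl refl h, THEN iffD1, rotated])
  then show "set_integrable lborel {\<alpha>..} (\<lambda>y. y powr (p - 1) * exp (- y))"
    using assms by simp
  have "I0 \<alpha> p = (LBINT y:{\<alpha>..}. ?h y)"
    unfolding I0_def im[symmetric] by (rule subst(2)[symmetric]) (auto simp: im)
  also have "\<dots> = (LBINT y:{\<alpha>..}. \<alpha> powr (- p) * (y powr (p - 1) * exp (- y)))"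
    by (rule set_lebesgue_integral_cong) (use h in auto)
  finally show "I0 \<alpha> p = \<alpha> powr (- p) * upper_Gamma p \<alpha>"
    by (simp add: upper_Gamma_def)
qed

section \<open>Differentiation of \<open>I0\<close> in its parameter \<open>p\<close>\<close>

lemma abs_exp_minus_one_le:
  fixes u :: real
  shows "\<bar>exp u - 1\<bar> \<le> \<bar>u\<bar> * exp \<bar>u\<bar>"
proof (cases "u \<ge> 0")
  case True
  \<comment> \<open>The tangent bound for \<open>exp (- u)\<close>, multiplied by
    \<open>exp u\<close>, rearranges to \<open>exp u - 1 \<le> u * exp u\<close>.\<close>
  have "(1 - u) * exp u \<le> exp (- u) * exp u"
    using exp_ge_add_one_self[of "- u"] by (intro mult_right_mono) auto
  then show ?thesis
    using True by (simp add: algebra_simps flip: exp_add)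
next
  case False
  then have "1 - exp u \<le> - u" "- u * 1 \<le> - u * exp (- u)"
    using exp_ge_add_one_self[of u] by (linarith, intro mult_left_mono) auto
  then have "1 - exp u \<le> - u * exp (- u)"
    by linarith
  then show ?thesis
    using False by simp
qed

text \<open>Differentiation under the integral sign: dominated convergence is applied to the
  difference quotients along an arbitrary null sequence of nonzero increments.\<close>

lemma I0_has_real_derivative:
  fixes \<alpha> p :: real
  assumes "\<alpha> > 0"
  shows "(I0 \<alpha> has_real_derivative Ilog \<alpha> p) (at p)"
  unfolding DERIV_def tendsto_at_iff_sequentially
proof (intro allI impI)
  fix X :: "nat \<Rightarrow> real"
  assume X: "\<forall>n. X n \<in> UNIV - {0}" and lim: "X \<longlonglongrightarrow> 0"
  obtain M where M: "\<And>n. \<bar>X n\<bar> \<le> M"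
    using convergent_imp_Bseq[of X] lim by (auto simp: convergent_def Bseq_def)
  let ?F = "\<lambda>p q. q powr (p - 1) * exp (- \<alpha> * q)"
  \<comment> \<open>The majorant: the bound on \<open>exp u - 1\<close> at
    \<open>u = X n * ln q\<close> leaves a factor \<open>ln q\<close> and a factor at most
    \<open>q powr M\<close>, uniformly in \<open>n\<close>. Raising the exponent by \<open>M\<close>
    does not affect integrability.\<close>
  let ?w = "\<lambda>q. ln q * q powr (p - 1 + M) * exp (- \<alpha> * q)"
  let ?D = "\<lambda>n q. (?F (p + X n) q - ?F p q) / X n"
  have intF: "set_integrable lborel {1..} (?F r)" for r
    by (rule set_integrable_powr_exp[OF assms])
  have eq: "?D n q = exp (- \<alpha> * q) * q powr (p - 1) * ((exp (X n * ln q) - 1) / X n)"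
    if "q \<ge> 1" for n q
  proof -
    have "q powr (p + X n - 1) = q powr (p - 1) * exp (X n * ln q)"
      using that by (simp add: powr_def algebra_simps flip: exp_add)
    then show ?thesis
      by (simp add: algebra_simps diff_divide_distrib)
  qed
  have bound: "\<bar>?D n q\<bar> \<le> ?w q" if q: "q \<ge> 1" for n q
  proof -
    have "\<bar>exp (X n * ln q) - 1\<bar> \<le> \<bar>X n\<bar> * (ln q * exp (\<bar>X n\<bar> * ln q))"
      using abs_exp_minus_one_le[of "X n * ln q"] q by (simp add: abs_mult mult_ac)
    then have "\<bar>(exp (X n * ln q) - 1) / X n\<bar> \<le> ln q * exp (\<bar>X n\<bar> * ln q)"
      using X by (simp add: abs_divide divide_le_eq mult_ac)
    also have "\<dots> \<le> ln q * exp (M * ln q)"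
      using q M[of n] by (intro mult_left_mono) (auto intro: mult_right_mono)
    finally have "\<bar>(exp (X n * ln q) - 1) / X n\<bar> \<le> ln q * q powr M"
      using q by (simp add: powr_def)
    then have "exp (- \<alpha> * q) * q powr (p - 1) * \<bar>(exp (X n * ln q) - 1) / X n\<bar>
        \<le> exp (- \<alpha> * q) * q powr (p - 1) * (ln q * q powr M)"
      by (intro mult_left_mono) auto
    then show ?thesis
      unfolding eq[OF q] abs_mult by (simp add: powr_add mult_ac)
  qed
  have "(\<lambda>n. ?D n q) \<longlonglongrightarrow> ln q * q powr (p - 1) * exp (- \<alpha> * q)" if q: "q \<ge> 1" for q
  proof -
    \<comment> \<open>The pointwise limit is the derivative of \<open>q powr h\<close> in
      \<open>h\<close> at 0, written through \<open>exp\<close>.\<close>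
    have "((\<lambda>h. exp (h * ln q)) has_real_derivative ln q) (at 0)"
      by (auto intro!: derivative_eq_intros)
    then have "((\<lambda>h. (exp (h * ln q) - 1) / h) \<longlongrightarrow> ln q) (at 0)"
      by (simp add: DERIV_def)
    then have "(\<lambda>n. (exp (X n * ln q) - 1) / X n) \<longlonglongrightarrow> ln q"
      using X lim by (auto simp: tendsto_at_iff_sequentially comp_def)
    then have "(\<lambda>n. ?D n q) \<longlonglongrightarrow> exp (- \<alpha> * q) * q powr (p - 1) * ln q"
      unfolding eq[OF q] by (intro tendsto_intros)
    then show ?thesis
      by (simp add: mult_ac)
  qed
  then have "(\<lambda>n. LBINT q:{1..}. ?D n q) \<longlonglongrightarrow> Ilog \<alpha> p"
    unfolding Ilog_def set_lebesgue_integral_def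
  proof (intro integral_dominated_convergence)
    show "integrable lborel (\<lambda>q. indicator {1..} q *\<^sub>R ?w q)"
      using set_integrable_ln_powr_exp[OF assms] by (simp add: set_integrable_def)
    show "AE q in lborel. norm (indicator {1..} q *\<^sub>R ?D n q) \<le> indicator {1..} q *\<^sub>R ?w q" for n
      using bound by (intro AE_I2) (simp split: split_indicator)
  qed (auto split: split_indicator)
  moreover have "(LBINT q:{1..}. ?D n q) = (I0 \<alpha> (p + X n) - I0 \<alpha> p) / X n" for n
    using intF[of "p + X n"] intF[of p] by (simp add: I0_def)
  ultimately show "((\<lambda>h. (I0 \<alpha> (p + h) - I0 \<alpha> p) / h) \<circ> X) \<longlonglongrightarrow> Ilog \<alpha> p"
    by (simp only: comp_def)
qed

section \<open>The substitution \<open>q = exp (2 * v - m)\<close>\<close>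

lemma
  fixes \<alpha> p m :: real
  assumes "\<alpha> > 0"
  defines "g \<equiv> \<lambda>v. exp (2 * v - m)"
    and "F \<equiv> \<lambda>q. (ln q + m) * (q powr (p - 1) * exp (- \<alpha> * q))"
  shows set_integrable_exp_substitution:
      "set_integrable lborel {m / 2..} (\<lambda>v. 2 * g v * F (g v))"
    and set_integral_exp_substitution:
      "(LBINT v:{m / 2..}. 2 * g v * F (g v)) = Ilog \<alpha> p + m * I0 \<alpha> p"
proof -
  \<comment> \<open>\<open>g\<close> is increasing with value 1 at \<open>m / 2\<close>, so the
    half-line of the kernel becomes that of \<open>I0\<close> and \<open>Ilog\<close>.\<close>
  have im: "g ` {m / 2..} = {1..}"
  proof (intro equalityI subsetI)
    fix q :: real assume "q \<in> {1..}"
    then show "q \<in> g ` {m / 2..}"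
      by (intro image_eqI[of _ _ "ln q / 2 + m / 2"]) (auto simp: g_def distrib_left)
  qed (auto simp: g_def)
  \<comment> \<open>At \<open>q = g v\<close> the factor \<open>ln q + m\<close> is
    \<open>2 * v\<close>; splitting it yields the logarithmic integral and \<open>m\<close> times
    the plain one.\<close>
  have F: "F = (\<lambda>q. ln q * q powr (p - 1) * exp (- \<alpha> * q) + m * (q powr (p - 1) * exp (- \<alpha> * q)))"
    by (simp add: F_def algebra_simps)
  have int: "set_integrable lborel {1..} (\<lambda>q. ln q * q powr (p - 1) * exp (- \<alpha> * q))"
      "set_integrable lborel {1..} (\<lambda>q. m * (q powr (p - 1) * exp (- \<alpha> * q)))"
    by (rule set_integrable_ln_powr_exp[OF assms(1)],
        rule set_integrable_mult_right[OF set_integrable_powr_exp[OF assms(1)]])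
  have F_int: "set_integrable lborel (g ` {m / 2..}) F"
    unfolding F im by (rule set_integral_add(1)[OF int])
  have der: "(g has_field_derivative 2 * g v) (at v within {m / 2..})" for v
    unfolding g_def by (auto intro!: derivative_eq_intros)
  have inj: "inj_on g {m / 2..}"
    by (auto simp: inj_on_def g_def)
  have meas: "F \<in> borel_measurable borel" "g \<in> borel_measurable borel"
      "(\<lambda>v. 2 * g v) \<in> borel_measurable borel"
    unfolding F_def g_def by measurable
  have abs: "\<bar>2 * g v\<bar> = 2 * g v" for v
    by (simp add: g_def)
  have S: "{m / 2..} \<in> sets borel" "g ` {m / 2..} \<in> sets borel"
    by (auto simp: im)
  note subst = set_integral_substitution_lborel[OF S der inj meas F_int, unfolded abs im]
  show "set_integrable lborel {m / 2..} (\<lambda>v. 2 * g v * F (g v))"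
    by (rule subst(1))
  have "(LBINT q:{1..}. F q) = Ilog \<alpha> p + m * I0 \<alpha> p"
    unfolding F set_integral_add(2)[OF int] by (simp add: Ilog_def I0_def)
  then show "(LBINT v:{m / 2..}. 2 * g v * F (g v)) = Ilog \<alpha> p + m * I0 \<alpha> p"
    using subst(2) by simp
qed

section \<open>Assembly of the kernel formula from its exponential terms\<close>

lemma
  fixes f :: "'b \<Rightarrow> 'a \<Rightarrow> 'c::{banach, second_countable_topology}"
  assumes "\<And>k. k \<in> K \<Longrightarrow> set_integrable M S (f k)"
  shows set_integrable_sum_fun: "set_integrable M S (\<lambda>v. \<Sum>k\<in>K. f k v)"
    and set_integral_sum_fun: "(LINT v:S|M. \<Sum>k\<in>K. f k v) = (\<Sum>k\<in>K. LINT v:S|M. f k v)"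
  using assms unfolding set_integrable_def set_lebesgue_integral_def
  by (simp_all add: scaleR_sum_right)

theorem mainTheorem1:
  fixes \<omega> :: real
    and I :: "'i set"
    and A lam c :: "'i \<Rightarrow> real"
    and \<phi> :: "real \<Rightarrow> real"
  assumes omega: "\<bar>\<omega>\<bar> < 1 / 2"
    and fin: "finite I"
    and c_pos: "\<And>i. i \<in> I \<Longrightarrow> c i > 0"
    and phi: "\<And>t. t \<ge> 0 \<Longrightarrow> \<phi> t = (\<Sum>i\<in>I. A i * exp (lam i * t - c i * exp (2 * t)))"
  shows
    "(\<forall>\<alpha>>0. \<forall>p.
        set_integrable lborel {\<alpha>..} (\<lambda>y. y powr (p - 1) * exp (- y)) \<and>
        set_integrable lborel {1..} (\<lambda>q. q powr (p - 1) * exp (- \<alpha> * q)) \<and>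
        set_integrable lborel {1..} (\<lambda>q. ln q * q powr (p - 1) * exp (- \<alpha> * q)) \<and>
        I0 \<alpha> p = \<alpha> powr (- p) * upper_Gamma p \<alpha> \<and>
        (I0 \<alpha> has_real_derivative Ilog \<alpha> p) (at p)) \<and>
     (\<forall>x\<ge>0. \<forall>y\<ge>0.
        set_integrable lborel {(x + y) / 2..} (weyl_integrand \<phi> \<omega> x y) \<and>
        (let \<alpha> = (\<lambda>i j. c i * exp (2 * x) + c j * exp (2 * y));
             p = (\<lambda>\<epsilon> i j. (lam i + lam j + 2 * \<epsilon> * \<omega>) / 2)
         in same_sign_weyl_kernel \<phi> \<omega> x y =
              1 / 16 * (\<Sum>\<epsilon>\<in>{1, -1}. \<Sum>i\<in>I. \<Sum>j\<in>I.
                A i * A j * exp ((lam i + \<epsilon> * \<omega>) * x) * exp ((lam j + \<epsilon> * \<omega>) * y) *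
                (Ilog (\<alpha> i j) (p \<epsilon> i j) + (x + y) * I0 (\<alpha> i j) (p \<epsilon> i j)))))"
proof (intro conjI allI impI)
  fix x y :: real
  assume xy: "x \<ge> 0" "y \<ge> 0"
  define m where "m = x + y"
  define S where "S = {m / 2..}"
  define \<alpha> where "\<alpha> = (\<lambda>i j. c i * exp (2 * x) + c j * exp (2 * y))"
  define p where "p = (\<lambda>\<epsilon> i j. (lam i + lam j + 2 * \<epsilon> * \<omega>) / 2)"
  define B where "B = (\<lambda>\<epsilon> i j. A i * A j * exp ((lam i + \<epsilon> * \<omega>) * x) * exp ((lam j + \<epsilon> * \<omega>) * y))"
  define E :: "real set" where "E = {1, -1}"
  \<comment> \<open>Flattening sign and indices into one index set lets integrability and the
    exchange of sum and integral be settled once.\<close>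
  define T where "T = E \<times> I \<times> I"
  define g where "g = (\<lambda>v. exp (2 * v - m))"
  \<comment> \<open>One term of the expanded integrand, in the form of the substitution result. The
    8 collects three halves: from \<open>cosh\<close>, from \<open>v = (ln (g v) + m) / 2\<close>,
    and from the 2 in the Jacobian \<open>2 * g v\<close>.\<close>
  define G where "G = (\<lambda>(\<epsilon>, i, j) v. B \<epsilon> i j / 8 *
      (2 * g v * ((ln (g v) + m) * (g v powr (p \<epsilon> i j - 1) * exp (- \<alpha> i j * g v)))))"
  have \<alpha>_pos: "\<alpha> i j > 0" if "i \<in> I" "j \<in> I" for i j
    using c_pos[OF that(1)] c_pos[OF that(2)] by (simp add: \<alpha>_def add_pos_pos)
  have G_int: "set_integrable lborel S (G k)" if k_in: "k \<in> T" for k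
  proof -
    obtain \<epsilon> i j where k: "k = (\<epsilon>, i, j)" "i \<in> I" "j \<in> I"
      using k_in by (auto simp: T_def)
    show ?thesis
      unfolding k G_def S_def g_def prod.case
      using set_integrable_exp_substitution[OF \<alpha>_pos[OF k(2,3)], of m "p \<epsilon> i j"]
      by (rule set_integrable_mult_right)
  qed
  have G_val: "(LBINT v:S. G (\<epsilon>, i, j) v) =
      B \<epsilon> i j / 8 * (Ilog (\<alpha> i j) (p \<epsilon> i j) + m * I0 (\<alpha> i j) (p \<epsilon> i j))"
    if "i \<in> I" "j \<in> I" for \<epsilon> i j
    unfolding G_def S_def g_def prod.case set_integral_mult_right
    by (simp only: set_integral_exp_substitution[OF \<alpha>_pos[OF that]])
  have summand: "v * (exp (2 * \<epsilon> * \<omega> * v) / 2) *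
        ((A i * exp (lam i * (v + (x - y) / 2) - c i * exp (2 * (v + (x - y) / 2)))) *
         (A j * exp (lam j * (v - (x - y) / 2) - c j * exp (2 * (v - (x - y) / 2)))))
      = G (\<epsilon>, i, j) v" for \<epsilon> i j v
  proof -
    \<comment> \<open>With \<open>s = v - m / 2\<close> the core arguments are \<open>x + s\<close>
      and \<open>y + s\<close>, and \<open>exp (2 * s)\<close> is \<open>g v\<close>. Hence both
      double exponentials share the factor \<open>g v\<close>.\<close>
    have "2 * (v + (x - y) / 2) = 2 * x + (2 * v - m)"
        "2 * (v - (x - y) / 2) = 2 * y + (2 * v - m)"
      by (auto simp: m_def field_simps)
    then have "c i * exp (2 * (v + (x - y) / 2)) + c j * exp (2 * (v - (x - y) / 2)) = \<alpha> i j * g v"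
      by (simp only: \<alpha>_def g_def exp_add distrib_right mult.assoc)
    \<comment> \<open>Apart from the parts in \<open>x\<close> and \<open>y\<close>, the linear
      exponents add up to \<open>p \<epsilon> i j * (2 * v - m)\<close>. One copy of
      \<open>2 * v - m\<close> is split off to supply the Jacobian factor \<open>g v\<close>,
      leaving the power \<open>p \<epsilon> i j - 1\<close>.\<close>
    then have "2 * \<epsilon> * \<omega> * v + (lam i * (v + (x - y) / 2) - c i * exp (2 * (v + (x - y) / 2)))
          + (lam j * (v - (x - y) / 2) - c j * exp (2 * (v - (x - y) / 2)))
        = (lam i + \<epsilon> * \<omega>) * x + (lam j + \<epsilon> * \<omega>) * y + (2 * v - m)
          + (p \<epsilon> i j - 1) * (2 * v - m) - \<alpha> i j * g v"
      by (simp add: p_def m_def field_simps)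
    then have "exp (2 * \<epsilon> * \<omega> * v)
          * exp (lam i * (v + (x - y) / 2) - c i * exp (2 * (v + (x - y) / 2)))
          * exp (lam j * (v - (x - y) / 2) - c j * exp (2 * (v - (x - y) / 2)))
        = exp ((lam i + \<epsilon> * \<omega>) * x) * exp ((lam j + \<epsilon> * \<omega>) * y) * g v
          * g v powr (p \<epsilon> i j - 1) * exp (- \<alpha> i j * g v)" (is "?L = ?R")
      by (simp add: g_def powr_def flip: exp_add)
    then have "v / 2 * (A i * A j) * ?L = v / 2 * (A i * A j) * ?R"
      by simp
    then show ?thesis
      by (simp add: G_def B_def g_def mult_ac)
  qed
  have expand: "weyl_integrand \<phi> \<omega> x y v = (\<Sum>k\<in>T. G k v)" if v: "v \<in> S" for v
  proof -
    \<comment> \<open>For \<open>v \<ge> m / 2\<close> these arguments are at least \<open>x\<close>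
      and \<open>y\<close>, so they lie where \<open>phi\<close> describes the core.\<close>
    have "v + (x - y) / 2 \<ge> 0" "v - (x - y) / 2 \<ge> 0"
      using v xy by (auto simp: S_def m_def field_simps)
    moreover have "cosh (2 * \<omega> * v) = (\<Sum>\<epsilon>\<in>E. exp (2 * \<epsilon> * \<omega> * v) / 2)"
      by (simp add: cosh_def E_def field_simps)
    ultimately have "weyl_integrand \<phi> \<omega> x y v =
        v * (\<Sum>\<epsilon>\<in>E. exp (2 * \<epsilon> * \<omega> * v) / 2) *
        ((\<Sum>i\<in>I. A i * exp (lam i * (v + (x - y) / 2) - c i * exp (2 * (v + (x - y) / 2)))) *
         (\<Sum>j\<in>I. A j * exp (lam j * (v - (x - y) / 2) - c j * exp (2 * (v - (x - y) / 2)))))"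
      by (simp add: weyl_integrand_def phi mult.assoc)
    also have "\<dots> = (\<Sum>\<epsilon>\<in>E. \<Sum>i\<in>I. \<Sum>j\<in>I. G (\<epsilon>, i, j) v)"
      \<comment> \<open>The stages fix the nesting: the product of the cores opens first, then
        everything moves under the sum over signs, and only then do factors enter the inner sums,
        where \<open>summand\<close> applies.\<close>
      by (simp only: sum_product, simp only: sum_distrib_left[of v] sum_distrib_right,
          simp only: sum_distrib_left summand)
    also have "\<dots> = (\<Sum>k\<in>T. G k v)"
      by (simp add: T_def sum.cartesian_product case_prod_unfold)
    finally show ?thesis .
  qed
  have S: "{(x + y) / 2..} = S"
    by (simp add: S_def m_def)
  show "set_integrable lborel {(x + y) / 2..} (weyl_integrand \<phi> \<omega> x y)"
    unfolding S
    by (rule set_integrable_cong[THEN iffD2, OF refl refl expand set_integrable_sum_fun[OF G_int]])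
  have "(LBINT v:S. weyl_integrand \<phi> \<omega> x y v) = (LBINT v:S. \<Sum>k\<in>T. G k v)"
    by (rule set_lebesgue_integral_cong) (auto simp: S_def expand[unfolded S_def])
  also have "\<dots> = (\<Sum>k\<in>T. LBINT v:S. G k v)"
    by (rule set_integral_sum_fun[OF G_int])
  also have "\<dots> = (\<Sum>\<epsilon>\<in>E. \<Sum>i\<in>I. \<Sum>j\<in>I. LBINT v:S. G (\<epsilon>, i, j) v)"
    by (simp add: T_def sum.cartesian_product case_prod_unfold)
  also have "\<dots> = 1 / 8 * (\<Sum>\<epsilon>\<in>E. \<Sum>i\<in>I. \<Sum>j\<in>I.
      B \<epsilon> i j * (Ilog (\<alpha> i j) (p \<epsilon> i j) + m * I0 (\<alpha> i j) (p \<epsilon> i j)))"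
    unfolding sum_distrib_left by (intro sum.cong refl) (simp add: G_val)
  \<comment> \<open>The factor \<open>1 / 2\<close> in front of the kernel turns
    \<open>1 / 8\<close> into \<open>1 / 16\<close>.\<close>
  finally have "same_sign_weyl_kernel \<phi> \<omega> x y = 1 / 16 * (\<Sum>\<epsilon>\<in>E. \<Sum>i\<in>I. \<Sum>j\<in>I.
      B \<epsilon> i j * (Ilog (\<alpha> i j) (p \<epsilon> i j) + m * I0 (\<alpha> i j) (p \<epsilon> i j)))"
    by (simp add: same_sign_weyl_kernel_def S)
  then show "let \<alpha> = (\<lambda>i j. c i * exp (2 * x) + c j * exp (2 * y));
        p = (\<lambda>\<epsilon> i j. (lam i + lam j + 2 * \<epsilon> * \<omega>) / 2)
      in same_sign_weyl_kernel \<phi> \<omega> x y =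
        1 / 16 * (\<Sum>\<epsilon>\<in>{1, -1}. \<Sum>i\<in>I. \<Sum>j\<in>I.
          A i * A j * exp ((lam i + \<epsilon> * \<omega>) * x) * exp ((lam j + \<epsilon> * \<omega>) * y) *
          (Ilog (\<alpha> i j) (p \<epsilon> i j) + (x + y) * I0 (\<alpha> i j) (p \<epsilon> i j)))"
    unfolding Let_def \<alpha>_def p_def B_def E_def m_def .
qed (use set_integrable_upper_Gamma set_integrable_powr_exp set_integrable_ln_powr_exp
    I0_eq_upper_Gamma I0_has_real_derivative in auto)

end
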